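(* Let $n,k$ be integers with $k\ge2$ and $n\ge2k$, let $A\in\Gamma_k$ be a real symmetric $n\times n$ matrix with eigenvalues $\lambda(A)=(\lambda_1,\dots,\lambda_n)$, and let $1\le i\le n$. If $$\left(\frac{n-k}{n}\sigma_k(A)-\sigma_k(\lambda(A)|i)\right)^2=\frac{n-k}{n}\,\operatorname{tr}\bigl(L_k(A)A\bigr)\,\sigma_{k-1}(\lambda(A)|i),$$ then all entries of $\lambda(A)|i$ are equal. In particular, $$\operatorname{tr}\bigl(L_k(A)A\bigr)=0\quad\Longrightarrow\quad A=\left(\frac{\sigma_k(A)}{\binom nk}\right)^{1/k}\mathrm{Id}.$$
   Context: For a real symmetric $n\times n$ matrix $A$, $\sigma_j(A)$ is the $j$-th elementary symmetric function of its eigenvalues ($\sigma_0=1$), and $\Gamma_k=\{A:\sigma_j(A)>0,\ 1\le j\le k\}$. $\lambda(A)|i$ is the $(n-1)$-tuple obtained from $\lambda(A)$ by deleting $\lambda_i$, and $\sigma_j$ of a tuple is its $j$-th elementary symmetric function. The Newton tensor is $T_j(A)=\sigma_j(A)\,\mathrm{Id}-\sigma_{j-1}(A)A+\cdots+(-1)^jA^j$, and $L_k(A)=\frac{n-k}{n}\sigma_k(A)\,\mathrm{Id}-T_k(A)$. *)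

theory Defs
  imports Complex_Main "HOL-Library.Multiset" "HOL-Computational_Algebra.Polynomial"
    "Jordan_Normal_Form.Char_Poly"
begin

text \<open>
  A tuple is a function on a finite index set \<open>I\<close>; deleting the entry \<open>i\<close> means passing
  from \<open>I\<close> to \<open>I - {i}\<close>.
\<close>

definition elem_sym :: "nat \<Rightarrow> nat set \<Rightarrow> (nat \<Rightarrow> real) \<Rightarrow> real" where
  "elem_sym j I x = (\<Sum>S | S \<subseteq> I \<and> card S = j. \<Prod>i\<in>S. x i)"

text \<open>
  The real roots of the characteristic polynomial, with multiplicity. For a real symmetric
  matrix these are all its eigenvalues.
\<close>

definition eigenvalues :: "real mat \<Rightarrow> real multiset" where
  "eigenvalues A = proots (char_poly A)"

definition eigenvalue_tuple :: "nat \<Rightarrow> real mat \<Rightarrow> (nat \<Rightarrow> real) \<Rightarrow> bool" where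
  "eigenvalue_tuple n A x \<longleftrightarrow> image_mset x (mset_set {..<n}) = eigenvalues A"

text \<open>
  The elementary symmetric functions do not depend on the order of the entries, so any
  enumeration of the eigenvalues will do; we take the increasing one.
\<close>

definition sigma :: "nat \<Rightarrow> real mat \<Rightarrow> real" where
  "sigma j A = (let xs = sorted_list_of_multiset (eigenvalues A)
                in elem_sym j {..<length xs} (\<lambda>i. xs ! i))"

definition Gamma_cone :: "nat \<Rightarrow> nat \<Rightarrow> real mat set" where
  "Gamma_cone n k = {A \<in> carrier_mat n n. transpose_mat A = A \<and> (\<forall>j\<in>{1..k}. sigma j A > 0)}"

definition mat_trace :: "real mat \<Rightarrow> real" where
  "mat_trace A = sum_list (diag_mat A)"

text \<open>
  \<open>\<Sum>\<^sub>l (-1)\<^sup>l \<sigma>\<^sub>j\<^sub>-\<^sub>l(A) A\<^sup>l\<close>, written entrywise because matrices of varying size are not an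
  instance of the type class used by the summation operator.
\<close>

definition newton_tensor :: "nat \<Rightarrow> real mat \<Rightarrow> real mat" where
  "newton_tensor j A =
    mat (dim_row A) (dim_row A) (\<lambda>rc. \<Sum>l\<le>j. (- 1) ^ l * sigma (j - l) A * (A ^\<^sub>m l) $$ rc)"

definition L_tensor :: "nat \<Rightarrow> real mat \<Rightarrow> real mat" where
  "L_tensor k A = (let n = dim_row A in
    ((real n - real k) / real n * sigma k A) \<cdot>\<^sub>m 1\<^sub>m n - newton_tensor k A)"

end

theory Submission
  imports Defs "HOL-Computational_Algebra.Fundamental_Theorem_Algebra"
    "Jordan_Normal_Form.Schur_Decomposition"
begin

text \<open>
  Write \<open>x\<close> for the deleted eigenvalue, \<open>s\<^sub>j\<close> for the elementary symmetric functions of the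
  other \<open>m = n - 1\<close> eigenvalues, and \<open>c = (n - k) / n\<close>. The Newton identities turn
  \<open>tr (L\<^sub>k(A) A)\<close> into \<open>c \<sigma>\<^sub>k \<sigma>\<^sub>1 - (k + 1) \<sigma>\<^sub>k\<^sub>+\<^sub>1\<close> (\<open>mat_trace_L_tensor_mult\<close>), so the equation to be
  studied is one between polynomials in \<open>x\<close> and the \<open>s\<^sub>j\<close>. Substituting \<open>\<sigma>\<^sub>j = s\<^sub>j + x s\<^sub>j\<^sub>-\<^sub>1\<close>, the terms
  quadratic in \<open>x\<close> cancel and the right side minus the left side becomes

    \<open>c \<sigma>\<^sub>k D / n + G / n\<close> with \<open>D = (n - k) s\<^sub>1 s\<^sub>k\<^sub>-\<^sub>1 - k (n - 1) s\<^sub>k\<close> and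
    \<open>G = k (n - 1 - k) s\<^sub>k\<^sup>2 - (k + 1) (n - k) s\<^sub>k\<^sub>-\<^sub>1 s\<^sub>k\<^sub>+\<^sub>1\<close>

  (\<open>deleted_entry_identity\<close>). Here \<open>G \<ge> 0\<close> is exactly the Newton inequality for the \<open>m\<close> remaining
  eigenvalues, which holds for real numbers of any sign. Since \<open>A \<in> \<Gamma>\<^sub>k\<close>, the numbers \<open>s\<^sub>0, ..., s\<^sub>k\<^sub>-\<^sub>1\<close>
  are positive (\<open>elem_sym_pos_remove\<close>), and then the Newton inequalities of lower index say that
  the normalized quotients \<open>s\<^sub>j / s\<^sub>j\<^sub>-\<^sub>1\<close> do not increase, so that \<open>D \<ge> 0\<close>. If the remaining eigenvalues are
  not all equal, the very first of these inequalities is strict, since it compares \<open>s\<^sub>1\<^sup>2\<close> with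
  \<open>s\<^sub>2\<close> and is an instance of the Cauchy-Schwarz inequality; strictness propagates to \<open>D > 0\<close>
  (\<open>maclaurin_quotient_less\<close>), and as \<open>c \<sigma>\<^sub>k > 0\<close> the two sides differ
  (\<open>deleted_entry_inequality\<close>).

  If \<open>tr (L\<^sub>k(A) A) = 0\<close>, the right side vanishes and the left side is a square, so the strict
  inequality is impossible for every choice of the deleted index. Any two eigenvalues survive the
  deletion of a third one, hence all of them agree, and a symmetric matrix with a single
  eigenvalue is a multiple of the identity.
\<close>

section \<open>Complex polynomials with only real zeros\<close>

text \<open>
  The zero polynomial does not count as real-rooted, so differentiation must stop in time: this is
  what the bounds on the degree below are for.
\<close>

definition real_rooted :: "complex poly \<Rightarrow> bool" where
  "real_rooted p \<longleftrightarrow> (\<forall>z. poly p z = 0 \<longrightarrow> z \<in> \<real>)"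

text \<open>
  The Gauss-Lucas argument: for a pole \<open>r\<close> on the real axis, \<open>1 / (z - r)\<close> lies in the open half plane
  opposite to that of \<open>z\<close>, so a sum of such terms, which is a logarithmic derivative, cannot vanish
  off the axis.
\<close>

lemma log_derivative_half_plane:
  assumes "finite I" "I \<noteq> {}" "\<And>i. i \<in> I \<Longrightarrow> r i \<in> \<real>" "Im z \<noteq> 0"
  shows "Im z * Im (\<Sum>i\<in>I. 1 / (z - r i)) < 0"
proof -
  have "Im z * Im (1 / (z - r i)) < 0" if "i \<in> I" for i
  proof -
    have [simp]: "Im (r i) = 0"
      using assms(3)[OF that] by (simp add: complex_is_Real_iff)
    have "Im z * Im (1 / (z - r i)) = - ((Im z)\<^sup>2 / ((Re z - Re (r i))\<^sup>2 + (Im z)\<^sup>2))"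
      by (simp add: Im_divide power2_eq_square)
    moreover have "(Im z)\<^sup>2 / ((Re z - Re (r i))\<^sup>2 + (Im z)\<^sup>2) > 0"
      using assms(4) by (intro divide_pos_pos add_nonneg_pos) auto
    ultimately show ?thesis by linarith
  qed
  then have "(\<Sum>i\<in>I. Im z * Im (1 / (z - r i))) < (\<Sum>i\<in>I. 0)"
    using assms(1,2) by (intro sum_strict_mono)
  then show ?thesis by (simp only: Im_sum sum_distrib_left sum.neutral_const)
qed

text \<open>
  Off the real axis \<open>p' / p\<close> is the sum of the terms \<open>1 / (z - r)\<close> over the zeros \<open>r\<close> of \<open>p\<close>, all real.
\<close>

lemma real_rooted_pderiv:
  assumes "real_rooted p" "degree p > 0"
  shows "real_rooted (pderiv p)"
  unfolding real_rooted_def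
proof (intro allI impI)
  fix z assume z: "poly (pderiv p) z = 0"
  obtain root where p: "Polynomial.smult (lead_coeff p) (\<Prod>i<degree p. [:-root i, 1:]) = p"
    by (rule complex_poly_decompose')
  define F where "F = (\<Prod>i<degree p. [:-root i, 1:])"
  have lc: "lead_coeff p \<noteq> 0" using assms(2) by auto
  have root: "root i \<in> \<real>" if "i < degree p" for i
  proof -
    have "poly p (root i) = 0"
      using that by (subst p[symmetric]) (auto simp: poly_prod)
    then show ?thesis using assms(1) by (simp add: real_rooted_def)
  qed
  show "z \<in> \<real>"
  proof (rule ccontr)
    assume "z \<notin> \<real>"
    then have Im: "Im z \<noteq> 0" by (simp add: complex_is_Real_iff)
    have nz: "z - root i \<noteq> 0" if "i < degree p" for i
      using root[OF that] \<open>z \<notin> \<real>\<close> by auto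
    have F0: "poly F z \<noteq> 0"
      using nz by (auto simp: F_def poly_prod)
    have "poly (pderiv F) z = (\<Sum>i<degree p. poly (\<Prod>j\<in>{..<degree p} - {i}. [:-root j, 1:]) z)"
      unfolding F_def pderiv_prod by (simp add: poly_sum pderiv_pCons)
    also have "\<dots> = (\<Sum>i<degree p. poly F z * (1 / (z - root i)))"
    proof (rule sum.cong)
      fix i assume i: "i \<in> {..<degree p}"
      have "F = [:-root i, 1:] * (\<Prod>j\<in>{..<degree p} - {i}. [:-root j, 1:])"
        unfolding F_def using i by (intro prod.remove) auto
      then have "poly F z = (z - root i) * poly (\<Prod>j\<in>{..<degree p} - {i}. [:-root j, 1:]) z"
        by (simp only: poly_mult) simp
      then show "poly (\<Prod>j\<in>{..<degree p} - {i}. [:-root j, 1:]) z = poly F z * (1 / (z - root i))"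
        using nz[of i] i by simp
    qed simp
    finally have "poly (pderiv F) z = poly F z * (\<Sum>i<degree p. 1 / (z - root i))"
      by (simp add: sum_distrib_left)
    moreover have "poly (pderiv F) z = 0"
    proof -
      have "pderiv p = Polynomial.smult (lead_coeff p) (pderiv F)"
        by (subst p[symmetric]) (simp only: pderiv_smult F_def)
      then show ?thesis using z lc by simp
    qed
    ultimately have "(\<Sum>i<degree p. 1 / (z - root i)) = 0"
      using F0 by simp
    moreover have "Im z * Im (\<Sum>i<degree p. 1 / (z - root i)) < 0"
      using assms(2) root Im by (intro log_derivative_half_plane) auto
    ultimately show False by simp
  qed
qed

lemma degree_higher_pderiv_complex: "degree ((pderiv ^^ m) (p :: complex poly)) = degree p - m"
  by (induction m) (auto simp: degree_pderiv)

lemma real_rooted_higher_pderiv: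
  assumes "real_rooted p" "m \<le> degree p"
  shows "real_rooted ((pderiv ^^ m) p)"
  using assms(2)
proof (induction m)
  case (Suc m)
  then show ?case
    by (auto intro!: real_rooted_pderiv simp: degree_higher_pderiv_complex)
qed (use assms in simp)

text \<open>
  The zeros of the reflected polynomial are the inverses of the nonzero zeros.
\<close>

lemma real_rooted_reflect_poly:
  assumes "real_rooted p" "p \<noteq> 0"
  shows "real_rooted (reflect_poly p)"
  unfolding real_rooted_def
proof (intro allI impI)
  fix z assume z: "poly (reflect_poly p) z = 0"
  then have z0: "z \<noteq> 0" using assms(2) by auto
  have "poly p (inverse z) = 0"
    using z z0 by (simp add: poly_reflect_poly_nz)
  then have "inverse z \<in> \<real>" using assms(1) unfolding real_rooted_def by blast
  then show "z \<in> \<real>" by (metis Reals_inverse inverse_inverse_eq)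
qed

lemma real_rooted_quadratic_discriminant:
  fixes a b c :: real
  assumes "real_rooted [:of_real c, of_real b, of_real a:]" "a \<noteq> 0"
  shows "4 * a * c \<le> b\<^sup>2"
proof (rule ccontr)
  assume neg: "\<not> 4 * a * c \<le> b\<^sup>2"
  define s where "s = sqrt (4 * a * c - b\<^sup>2)"
  have s: "s > 0" "s\<^sup>2 = 4 * a * c - b\<^sup>2" using neg by (auto simp: s_def)
  define z where "z = Complex (- b / (2 * a)) (s / (2 * a))"
  have "poly [:of_real c, of_real b, of_real a:] z = 0"
  proof (rule complex_eqI)
    have "Re (poly [:of_real c, of_real b, of_real a:] z) = c - b\<^sup>2 / (4 * a) - s\<^sup>2 / (4 * a)"
      using assms(2) by (simp add: z_def power2_eq_square field_simps)
    also have "\<dots> = c - (b\<^sup>2 + s\<^sup>2) / (4 * a)" by (simp add: add_divide_distrib)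
    also have "\<dots> = 0" using assms(2) s(2) by simp
    finally show "Re (poly [:of_real c, of_real b, of_real a:] z) = Re 0" by simp
    show "Im (poly [:of_real c, of_real b, of_real a:] z) = Im 0"
      using assms(2) by (simp add: z_def field_simps)
  qed
  then have "z \<in> \<real>" using assms(1) by (simp add: real_rooted_def)
  then show False using s(1) assms(2) by (simp add: complex_is_Real_iff z_def)
qed

section \<open>Newton inequalities for the coefficients of real-rooted polynomials\<close>

lemma pochhammer_of_nat_Suc_eq:
  "pochhammer (of_nat (Suc l)) h = (fact (l + h) / fact l :: 'a :: field_char_0)"
proof -
  have "pochhammer (1 :: 'a) (l + h) = pochhammer 1 l * pochhammer (1 + of_nat l) h"
    by (rule pochhammer_product')
  then show ?thesis by (simp add: pochhammer_fact[symmetric] field_simps)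
qed

text \<open>
  Reflecting puts the three lowest coefficients on top, and \<open>N - 2\<close> differentiations then leave a
  quadratic polynomial made of these three alone. Both operations preserve real-rootedness, and the
  inequality is that of its discriminant.
\<close>

lemma newton_inequality_lowest_coeffs:
  fixes a :: "nat \<Rightarrow> real"
  assumes "real_rooted p" "degree p = N" "N \<ge> 2" "\<And>j. coeff p j = of_real (a j)"
  shows "2 * real N * a 0 * a 2 \<le> (real N - 1) * (a 1)\<^sup>2"
  \<comment> \<open>A zero constant coefficient would make the reflection drop the degree, but then the
    left side is zero.\<close>
proof (cases "a 0 = 0")
  case True
  then show ?thesis using assms(3) by simp
next
  case False
  define M where "M = N - 2"
  have N: "N = Suc (Suc M)" using assms(3) by (simp add: M_def)
  define q where "q = (pderiv ^^ M) (reflect_poly p)"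
  have p0: "coeff p 0 \<noteq> 0" using False assms(4) by simp
  then have degr: "degree (reflect_poly p) = N" using assms(2) by simp
  have degq: "degree q = 2"
    unfolding q_def by (simp add: degree_higher_pderiv_complex degr N)
  have rr: "real_rooted q"
    unfolding q_def using assms(1) p0 degr N
    by (intro real_rooted_higher_pderiv real_rooted_reflect_poly) auto
  note ph = pochhammer_of_nat_Suc_eq[where 'a = complex and h = M]
  have c0: "coeff q 0 = of_real (fact M * a 2)"
    unfolding q_def using ph[of 0]
    by (simp add: coeff_higher_pderiv coeff_reflect_poly assms(2,4) N numeral_2_eq_2)
  have c1: "coeff q 1 = of_real (fact (Suc M) * a 1)"
    unfolding q_def using ph[of 1]
    by (simp add: coeff_higher_pderiv coeff_reflect_poly assms(2,4) N)
  have c2: "coeff q 2 = of_real (fact (Suc (Suc M)) / 2 * a 0)"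
    unfolding q_def using ph[of 2]
    by (simp add: coeff_higher_pderiv coeff_reflect_poly assms(2,4) N numeral_2_eq_2)
  have q: "q = [:coeff q 0, coeff q 1, coeff q 2:]"
  proof (rule poly_eqI)
    fix l
    show "coeff q l = coeff [:coeff q 0, coeff q 1, coeff q 2:] l"
    proof (cases "l \<le> 2")
      case True
      then have "l = 0 \<or> l = 1 \<or> l = 2" by auto
      then show ?thesis by (auto simp: numeral_2_eq_2)
    next
      case False
      then have "coeff q l = 0" using degq by (simp add: coeff_eq_0)
      moreover have "coeff [:coeff q 0, coeff q 1, coeff q 2:] l = 0"
        using False by (intro coeff_eq_0) auto
      ultimately show ?thesis by simp
    qed
  qed
  have "4 * (fact (Suc (Suc M)) / 2 * a 0) * (fact M * a 2) \<le> (fact (Suc M) * a 1)\<^sup>2"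
    using rr False q unfolding c0 c1 c2
    by (intro real_rooted_quadratic_discriminant) auto
  then have "(fact M * fact (Suc M)) * (2 * real N * a 0 * a 2)
      \<le> (fact M * fact (Suc M)) * ((real N - 1) * (a 1)\<^sup>2)"
    unfolding N by (simp add: power2_eq_square algebra_simps)
  then show ?thesis
    by (rule mult_left_le_imp_le) simp
qed

text \<open>
  Differentiating \<open>i - 1\<close> times makes the coefficients around index \<open>i\<close> the three lowest ones.
\<close>

theorem newton_inequality_coeffs:
  fixes a :: "nat \<Rightarrow> real"
  assumes "real_rooted p" "degree p = N" "\<And>j. coeff p j = of_real (a j)" "0 < i" "i < N"
  shows "(real i + 1) * (real N - real i + 1) * a (i - 1) * a (i + 1)
           \<le> real i * (real N - real i) * (a i)\<^sup>2"
proof -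
  obtain h where i: "i = Suc h" using assms(4) by (cases i) auto
  define b :: "nat \<Rightarrow> real" where "b l = pochhammer (of_nat (Suc l)) h * a (l + h)" for l
  have ineq: "2 * real (N - h) * b 0 * b 2 \<le> (real (N - h) - 1) * (b 1)\<^sup>2"
  proof (rule newton_inequality_lowest_coeffs)
    show "real_rooted ((pderiv ^^ h) p)"
      using assms i by (intro real_rooted_higher_pderiv) auto
    show "degree ((pderiv ^^ h) p) = N - h" "N - h \<ge> 2"
      using assms i by (auto simp: degree_higher_pderiv_complex)
    show "coeff ((pderiv ^^ h) p) j = of_real (b j)" for j
      by (simp add: coeff_higher_pderiv assms(3) b_def pochhammer_of_real[symmetric])
  qed
  have b: "b 0 = fact h * a h" "b 1 = fact (Suc h) * a (Suc h)"
      "b 2 = fact (Suc (Suc h)) / 2 * a (Suc (Suc h))"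
    unfolding b_def pochhammer_of_nat_Suc_eq by (auto simp: numeral_2_eq_2)
  have "2 * real (N - h) * (fact h * a h) * (fact (Suc (Suc h)) / 2 * a (Suc (Suc h)))
      \<le> (real (N - h) - 1) * (fact (Suc h) * a (Suc h))\<^sup>2"
    using ineq unfolding b .
  moreover have "2 * real (N - h) * (fact h * a h) * (fact (Suc (Suc h)) / 2 * a (Suc (Suc h)))
      = (fact h * fact (Suc h)) * ((real i + 1) * (real N - real i + 1) * a (i - 1) * a (i + 1))"
    using assms(5) by (simp add: i of_nat_diff field_simps)
  moreover have "(real (N - h) - 1) * (fact (Suc h) * a (Suc h))\<^sup>2
      = (fact h * fact (Suc h)) * (real i * (real N - real i) * (a i)\<^sup>2)"
    using assms(5) by (simp add: i of_nat_diff power2_eq_square algebra_simps)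
  ultimately have "(fact h * fact (Suc h)) * ((real i + 1) * (real N - real i + 1) * a (i - 1) * a (i + 1))
      \<le> (fact h * fact (Suc h)) * (real i * (real N - real i) * (a i)\<^sup>2)"
    by (simp only:)
  then show ?thesis
    by (rule mult_left_le_imp_le) simp
qed

section \<open>Elementary symmetric functions\<close>

lemma elem_sym_0 [simp]: "finite I \<Longrightarrow> elem_sym 0 I x = 1"
proof -
  assume "finite I"
  then have "{S. S \<subseteq> I \<and> card S = 0} = {{}}"
    by (auto dest: finite_subset)
  then show ?thesis by (simp add: elem_sym_def)
qed

lemma elem_sym_eq_0:
  assumes "finite I" "card I < j"
  shows "elem_sym j I x = 0"
proof -
  have "{S. S \<subseteq> I \<and> card S = j} = {}"
    using assms card_mono[OF assms(1)] by (auto simp: not_le[symmetric])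
  then show ?thesis unfolding elem_sym_def by (simp only: sum.empty)
qed

lemma elem_sym_Suc_insert:
  assumes "finite I" "a \<notin> I"
  shows "elem_sym (Suc j) (insert a I) x = elem_sym (Suc j) I x + x a * elem_sym j I x"
proof -
  let ?A = "{S. S \<subseteq> I \<and> card S = Suc j}"
  let ?B = "{S. S \<subseteq> I \<and> card S = j}"
  have split: "{S. S \<subseteq> insert a I \<and> card S = Suc j} = ?A \<union> insert a ` ?B" (is "?L = ?R")
  proof (intro equalityI subsetI)
    fix S assume S: "S \<in> ?L"
    then have fin: "finite S" using assms(1) finite_subset[of S "insert a I"] by auto
    show "S \<in> ?R"
    proof (cases "a \<in> S")
      case True
      then have "S = insert a (S - {a})" "S - {a} \<in> ?B" using S fin by auto
      then show ?thesis by blast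
    qed (use S in auto)
  next
    fix S assume "S \<in> ?R"
    then show "S \<in> ?L"
    proof
      assume "S \<in> insert a ` ?B"
      then obtain T where T: "S = insert a T" "T \<subseteq> I" "card T = j" by auto
      have "a \<notin> T" "finite T" using T(2) assms finite_subset by auto
      then show ?thesis using T by auto
    qed auto
  qed
  have fin: "finite ?A" "finite ?B" using assms(1) by auto
  have inj: "inj_on (insert a) ?B" using assms(2) by (auto simp: inj_on_def)
  have disj: "?A \<inter> insert a ` ?B = {}" using assms(2) by auto
  have "elem_sym (Suc j) (insert a I) x
      = (\<Sum>S\<in>?A. \<Prod>i\<in>S. x i) + (\<Sum>S\<in>insert a ` ?B. \<Prod>i\<in>S. x i)"
    unfolding elem_sym_def split using fin disj by (intro sum.union_disjoint) auto
  also have "(\<Sum>S\<in>insert a ` ?B. \<Prod>i\<in>S. x i) = (\<Sum>T\<in>?B. \<Prod>i\<in>insert a T. x i)"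
    using sum.reindex[OF inj] by simp
  also have "\<dots> = (\<Sum>T\<in>?B. x a * (\<Prod>i\<in>T. x i))"
  proof (rule sum.cong)
    fix T assume "T \<in> ?B"
    then have "a \<notin> T" "finite T" using assms finite_subset by auto
    then show "(\<Prod>i\<in>insert a T. x i) = x a * (\<Prod>i\<in>T. x i)" by simp
  qed simp
  finally show ?thesis by (simp add: elem_sym_def sum_distrib_left)
qed

lemma elem_sym_Suc_remove:
  assumes "finite I" "a \<in> I"
  shows "elem_sym (Suc j) I x = elem_sym (Suc j) (I - {a}) x + x a * elem_sym j (I - {a}) x"
  using elem_sym_Suc_insert[of "I - {a}" a j x] assms by (simp add: insert_absorb)

lemma elem_sym_1: "finite I \<Longrightarrow> elem_sym (Suc 0) I x = (\<Sum>i\<in>I. x i)"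
proof (induction I rule: finite_induct)
  case (insert a I)
  then show ?case by (simp add: elem_sym_Suc_insert)
qed (simp add: elem_sym_eq_0)

lemma elem_sym_2: "finite I \<Longrightarrow> 2 * elem_sym 2 I x = (\<Sum>i\<in>I. x i)\<^sup>2 - (\<Sum>i\<in>I. (x i)\<^sup>2)"
proof (induction I rule: finite_induct)
  case (insert a I)
  then show ?case
    by (simp add: elem_sym_Suc_insert elem_sym_1 numeral_2_eq_2) (simp add: power2_eq_square algebra_simps)
qed (simp add: elem_sym_eq_0)

text \<open>
  The target ring is left general because both the real and the complex product are used: the
  real one for comparing tuples with the same multiset of entries, the complex one for the Newton
  inequalities.
\<close>

lemma coeff_prod_linear_factors:
  assumes "finite I"
  shows "coeff (\<Prod>i\<in>I. [:of_real (x i), 1 :: 'a :: {comm_ring_1, real_algebra_1}:]) l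
           = of_real (if l \<le> card I then elem_sym (card I - l) I x else 0)"
  using assms
proof (induction I arbitrary: l rule: finite_induct)
  case empty
  show ?case by (cases l) auto
next
  case (insert a I)
  show ?case
  proof (cases l)
    case 0
    then show ?thesis
      using insert by (simp add: elem_sym_Suc_insert elem_sym_eq_0)
  next
    case (Suc h)
    show ?thesis
    proof (cases "l \<le> card I")
      case True
      then have "card I - h = Suc (card I - l)" using Suc by simp
      then show ?thesis
        using insert True Suc by (simp add: elem_sym_Suc_insert)
    qed (use insert Suc in auto)
  qed
qed

text \<open>
  The product of the linear factors depends on the multiset of entries only, and its coefficients
  are the elementary symmetric functions.
\<close>

lemma elem_sym_cong_mset:
  assumes "finite I" "finite J" "image_mset x (mset_set I) = image_mset y (mset_set J)"
  shows "elem_sym j I x = elem_sym j J y"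
proof -
  have card: "card I = card J"
    using arg_cong[OF assms(3), of size] assms(1,2) by simp
  have "(\<Prod>i\<in>I. [:of_real (x i), 1 :: real:]) = (\<Prod>u\<in>#image_mset x (mset_set I). [:u, 1:])"
    by (simp add: prod_unfold_prod_mset image_mset.compositionality comp_def)
  also have "\<dots> = (\<Prod>i\<in>J. [:of_real (y i), 1 :: real:])"
    unfolding assms(3) by (simp add: prod_unfold_prod_mset image_mset.compositionality comp_def)
  finally have eq: "(\<Prod>i\<in>I. [:of_real (x i), 1 :: real:]) = (\<Prod>i\<in>J. [:of_real (y i), 1 :: real:])" .
  show ?thesis
  proof (cases "j \<le> card I")
    case True
    then show ?thesis
      using arg_cong[OF eq, of "\<lambda>p. coeff p (card I - j)"] card
      unfolding coeff_prod_linear_factors[OF assms(1)] coeff_prod_linear_factors[OF assms(2)]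
      by simp
  qed (use assms card in \<open>simp add: elem_sym_eq_0\<close>)
qed

text \<open>
  The polynomial with zeros \<open>- x i\<close> has exact degree \<open>card I\<close> even when some entries vanish, so the
  binomial constants are the right ones; the index \<open>j\<close> here belongs to the coefficient of
  degree \<open>card I - j\<close>.
\<close>

theorem newton_inequality_elem_sym:
  assumes "finite I" "0 < j" "j < card I"
  shows "(real j + 1) * (real (card I) - real j + 1) * elem_sym (j - 1) I x * elem_sym (j + 1) I x
           \<le> real j * (real (card I) - real j) * (elem_sym j I x)\<^sup>2"
proof -
  define m where "m = card I"
  define P where "P = (\<Prod>i\<in>I. [:complex_of_real (x i), 1:])"
  define a where "a l = (if l \<le> m then elem_sym (m - l) I x else 0)" for l
  have "(real (m - j) + 1) * (real m - real (m - j) + 1) * a (m - j - 1) * a (m - j + 1)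
          \<le> real (m - j) * (real m - real (m - j)) * (a (m - j))\<^sup>2"
  proof (rule newton_inequality_coeffs)
    show "real_rooted P"
      unfolding real_rooted_def
    proof (intro allI impI)
      fix z assume "poly P z = 0"
      then obtain i where "of_real (x i) + z = 0"
        using assms(1) by (auto simp: P_def poly_prod)
      then have "z = of_real (- x i)" by (simp add: add_eq_0_iff)
      then show "z \<in> \<real>" by simp
    qed
    show "degree P = m" by (simp add: P_def m_def degree_prod_sum_eq)
    show "coeff P l = of_real (a l)" for l
      unfolding P_def a_def m_def by (rule coeff_prod_linear_factors[OF assms(1)])
  qed (use assms in \<open>auto simp: m_def\<close>)
  moreover have "m - (m - j - 1) = j + 1" "m - (m - j + 1) = j - 1" "m - (m - j) = j"
    "m - j + 1 \<le> m"
    using assms by (auto simp: m_def)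
  ultimately show ?thesis
    using assms by (simp add: a_def m_def of_nat_diff algebra_simps)
qed

text \<open>
  The difference of the two sides is \<open>m\<close> times the sum of the squared deviations of the entries
  from their mean, where \<open>m\<close> is the number of entries. In the proof the deviations are scaled by
  \<open>m\<close> to avoid a division.
\<close>

lemma elem_sym_2_less_if_nonconstant:
  assumes "finite I" "p \<in> I" "q \<in> I" "x p \<noteq> x q"
  shows "2 * real (card I) * elem_sym 2 I x < (real (card I) - 1) * (elem_sym (Suc 0) I x)\<^sup>2"
proof -
  define m where "m = real (card I)"
  define t where "t = (\<Sum>i\<in>I. x i)"
  have m: "m > 0" using assms by (auto simp: m_def card_gt_0_iff)
  have "(\<Sum>i\<in>I. (m * x i - t)\<^sup>2) = (\<Sum>i\<in>I. m\<^sup>2 * (x i)\<^sup>2 - 2 * m * t * x i + t\<^sup>2)"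
    by (intro sum.cong) (auto simp: power2_eq_square algebra_simps)
  also have "\<dots> = m\<^sup>2 * (\<Sum>i\<in>I. (x i)\<^sup>2) - 2 * m * t * t + m * t\<^sup>2"
    by (simp add: sum.distrib sum_subtractf sum_distrib_left[symmetric] t_def m_def)
  also have "\<dots> = m * (m * (\<Sum>i\<in>I. (x i)\<^sup>2) - t\<^sup>2)"
    by (simp add: power2_eq_square algebra_simps)
  finally have eq: "(\<Sum>i\<in>I. (m * x i - t)\<^sup>2) = m * (m * (\<Sum>i\<in>I. (x i)\<^sup>2) - t\<^sup>2)" .
  have "\<exists>i\<in>I. m * x i - t \<noteq> 0"
    using assms m by (metis eq_iff_diff_eq_0 less_numeral_extra(3) mult_cancel_left)
  then obtain i where "i \<in> I" "0 < (m * x i - t)\<^sup>2" by auto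
  then have "(\<Sum>i\<in>I. (m * x i - t)\<^sup>2) > 0"
    using assms(1) by (intro sum_pos2[of I i]) auto
  then have "t\<^sup>2 < m * (\<Sum>i\<in>I. (x i)\<^sup>2)"
    using m unfolding eq by (simp add: zero_less_mult_iff)
  moreover have "2 * elem_sym 2 I x = t\<^sup>2 - (\<Sum>i\<in>I. (x i)\<^sup>2)"
    using elem_sym_2[OF assms(1)] by (simp add: t_def)
  then have "2 * m * elem_sym 2 I x = m * (t\<^sup>2 - (\<Sum>i\<in>I. (x i)\<^sup>2))" by simp
  ultimately show ?thesis
    by (simp add: elem_sym_1[OF assms(1)] m_def[symmetric] t_def[symmetric] algebra_simps)
qed

text \<open>
  With \<open>p\<^sub>l\<close> denoting \<open>s\<^sub>l\<close> divided by its binomial coefficient, this is \<open>p\<^sub>j < p\<^sub>1 p\<^sub>j\<^sub>-\<^sub>1\<close>. As long as the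
  \<open>p\<^sub>l\<close> are positive, the Newton inequalities make \<open>p\<^sub>l / p\<^sub>l\<^sub>-\<^sub>1\<close> nonincreasing in \<open>l\<close>; starting from
  the strict inequality \<open>p\<^sub>2 / p\<^sub>1 < p\<^sub>1\<close> it never returns to \<open>p\<^sub>1\<close>.
\<close>

lemma maclaurin_quotient_less:
  assumes "finite I" "2 \<le> j" "j \<le> card I" "\<And>l. l < j \<Longrightarrow> elem_sym l I x > 0"
    and "2 * real (card I) * elem_sym 2 I x < (real (card I) - 1) * (elem_sym (Suc 0) I x)\<^sup>2"
  shows "real j * real (card I) * elem_sym j I x
           < (real (card I) - real j + 1) * elem_sym (Suc 0) I x * elem_sym (j - 1) I x"
  using assms(2-4)
proof (induction j rule: dec_induct)
  case base
  then show ?case using assms(5) by (simp add: power2_eq_square algebra_simps)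
next
  case (step j)
  define m s where "m = real (card I)" and "s = (\<lambda>l. elem_sym l I x)"
  have j: "real j \<ge> 2" "real j < m" using step by (auto simp: m_def)
  have pos: "s (j - 1) > 0" "s j > 0" using step by (auto simp: s_def)
  have IH: "real j * m * s j < (m - real j + 1) * s (Suc 0) * s (j - 1)"
    using step by (simp add: m_def s_def)
  have newton: "(real j + 1) * (m - real j + 1) * s (j - 1) * s (j + 1) \<le> real j * (m - real j) * (s j)\<^sup>2"
    unfolding m_def s_def using step assms(1) by (intro newton_inequality_elem_sym) auto
  have "(m - real j + 1) * s (j - 1) * ((real j + 1) * m * s (j + 1))
      = m * ((real j + 1) * (m - real j + 1) * s (j - 1) * s (j + 1))"
    by (simp only: mult.assoc mult.commute mult.left_commute)
  also have "\<dots> \<le> m * (real j * (m - real j) * (s j)\<^sup>2)"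
    using newton j by (intro mult_left_mono) auto
  also have "\<dots> = (m - real j) * s j * (real j * m * s j)"
    by (simp add: power2_eq_square algebra_simps)
  also have "\<dots> < (m - real j) * s j * ((m - real j + 1) * s (Suc 0) * s (j - 1))"
    using IH j pos by (intro mult_strict_left_mono) auto
  also have "\<dots> = (m - real j + 1) * s (j - 1) * ((m - real j) * s (Suc 0) * s j)"
    by (simp only: mult.assoc mult.commute mult.left_commute)
  finally have "(real j + 1) * m * s (j + 1) < (m - real j) * s (Suc 0) * s j"
    using j pos by (simp add: mult_less_cancel_left)
  then show ?case by (simp add: m_def s_def add.commute)
qed

text \<open>
  Deleting an entry maps the cone of index \<open>k\<close> into the cone of index \<open>k - 1\<close>. Let \<open>x\<close> be that
  entry and let the \<open>s\<^sub>j\<close> belong to the others. If \<open>s\<^sub>j > 0 \<ge> s\<^sub>j\<^sub>+\<^sub>1\<close>, then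
  positivity of \<open>s\<^sub>j\<^sub>+\<^sub>1 + x s\<^sub>j\<close> and \<open>s\<^sub>j\<^sub>+\<^sub>2 + x s\<^sub>j\<^sub>+\<^sub>1\<close> forces \<open>s\<^sub>j s\<^sub>j\<^sub>+\<^sub>2 > s\<^sub>j\<^sub>+\<^sub>1\<^sup>2\<close>, against the Newton
  inequality.
\<close>

lemma elem_sym_pos_remove:
  assumes "finite I" "a \<notin> I" "k \<le> card I"
    and pos: "\<And>j. j \<le> k \<Longrightarrow> elem_sym j (insert a I) x > 0"
    and "j < k"
  shows "elem_sym j I x > 0"
  using \<open>j < k\<close>
proof (induction j)
  case 0
  show ?case using assms(1) by simp
next
  case (Suc j)
  define m s where "m = real (card I)" and "s = (\<lambda>l. elem_sym l I x)"
  have s: "s j > 0" using Suc by (simp add: s_def)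
  have p1: "s (Suc j) + x a * s j > 0"
    using pos[of "Suc j"] Suc.prems assms(1,2) by (simp add: elem_sym_Suc_insert s_def)
  have p2: "s (Suc (Suc j)) + x a * s (Suc j) > 0"
    using pos[of "Suc (Suc j)"] Suc.prems assms(1,2) by (simp add: elem_sym_Suc_insert s_def)
  have newton: "(real j + 2) * (m - real j) * s j * s (Suc (Suc j)) \<le> (real j + 1) * (m - real j - 1) * (s (Suc j))\<^sup>2"
    using newton_inequality_elem_sym[OF assms(1), of "Suc j" x] Suc.prems assms(3)
    by (simp add: m_def s_def algebra_simps)
  have j: "m - real j - 1 > 0" using Suc.prems assms(3) by (simp add: m_def)
  show ?case
  proof (rule ccontr)
    assume "\<not> ?thesis"
    then have neg: "s (Suc j) \<le> 0" by (simp add: s_def)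
    have "(s (Suc j))\<^sup>2 = (- s (Suc j)) * (- s (Suc j))" by (simp add: power2_eq_square)
    also have "\<dots> \<le> (x a * s j) * (- s (Suc j))"
      using p1 neg by (intro mult_right_mono) auto
    also have "\<dots> = s j * (- x a * s (Suc j))" by simp
    also have "\<dots> < s j * s (Suc (Suc j))"
      using p2 s by (intro mult_strict_left_mono) auto
    finally have less: "(s (Suc j))\<^sup>2 < s j * s (Suc (Suc j))" .
    have "(real j + 1) * (m - real j - 1) * (s (Suc j))\<^sup>2 \<le> (real j + 1) * (m - real j - 1) * (s j * s (Suc (Suc j)))"
      using less j by (intro mult_left_mono) auto
    also have "\<dots> < (real j + 2) * (m - real j) * (s j * s (Suc (Suc j)))"
    proof (rule mult_strict_right_mono)
      show "(real j + 1) * (m - real j - 1) < (real j + 2) * (m - real j)"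
        using j by (intro mult_strict_mono) auto
      show "0 < s j * s (Suc (Suc j))"
        using less by (meson le_less_trans zero_le_power2)
    qed
    finally show False using newton by (simp only: mult.assoc) 
  qed
qed

section \<open>The inequality for a deleted entry\<close>

text \<open>
  Here \<open>N\<close> is the number of all entries, \<open>K\<close> the index \<open>k\<close> and \<open>x\<close> the deleted entry, while
  \<open>p = s\<^sub>k\<^sub>-\<^sub>1\<close>, \<open>q = s\<^sub>k\<close>, \<open>r = s\<^sub>k\<^sub>+\<^sub>1\<close> and \<open>s1 = s\<^sub>1\<close> belong to the remaining ones. The first
  summand keeps the factor \<open>q + x p = \<sigma>\<^sub>k\<close> together because its sign is known, while that of \<open>x\<close>
  is not.
\<close>

lemma deleted_entry_identity:
  fixes N K x s1 p q r :: real
  assumes "N \<noteq> 0"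
  defines "c \<equiv> (N - K) / N"
  shows "c * (c * (q + x * p) * (s1 + x) - (K + 1) * (r + x * q)) * p - (c * (q + x * p) - q)\<^sup>2
     = (c * (q + x * p) * ((N - K) * s1 * p - K * (N - 1) * q)
        + (K * (N - 1 - K) * q\<^sup>2 - (K + 1) * (N - K) * p * r)) / N"
  unfolding c_def using assms(1) by (simp add: field_simps power2_eq_square power3_eq_cube)

text \<open>
  In \<open>deleted_entry_identity\<close> the first summand is positive by \<open>maclaurin_quotient_less\<close> and the
  second is nonnegative by the Newton inequality of index \<open>k\<close>.
\<close>

lemma deleted_entry_inequality:
  assumes fin: "finite I" and a: "a \<notin> I" and k: "2 \<le> k" "k < card I"
    and pos: "\<And>j. j \<le> k \<Longrightarrow> elem_sym j (insert a I) x > 0"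
    and pq: "p \<in> I" "q \<in> I" "x p \<noteq> x q"
  defines "n \<equiv> real (card (insert a I))"
  defines "c \<equiv> (n - real k) / n"
  shows "(c * elem_sym k (insert a I) x - elem_sym k I x)\<^sup>2
     < c * (c * elem_sym k (insert a I) x * elem_sym (Suc 0) (insert a I) x
            - (real k + 1) * elem_sym (Suc k) (insert a I) x) * elem_sym (k - 1) I x"
proof -
  define s where "s = (\<lambda>l. elem_sym l I x)"
  obtain h where h: "k = Suc h" using k by (cases k) auto
  have n: "n = real (card I) + 1" using fin a by (simp add: n_def)
  have s_pos: "s l > 0" if "l < k" for l
    unfolding s_def using fin a _ pos that by (rule elem_sym_pos_remove) (use k in auto)
  have ins: "elem_sym k (insert a I) x = s k + x a * s (k - 1)"
    "elem_sym (Suc 0) (insert a I) x = s (Suc 0) + x a"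
    "elem_sym (Suc k) (insert a I) x = s (Suc k) + x a * s k"
    using fin a by (auto simp: s_def elem_sym_Suc_insert h)
  have D: "real k * (n - 1) * s k < (n - real k) * s (Suc 0) * s (k - 1)"
    using maclaurin_quotient_less[OF fin, of k x] k s_pos elem_sym_2_less_if_nonconstant[OF fin pq]
    by (simp add: s_def n diff_add_eq)
  have G: "(real k + 1) * (n - real k) * s (k - 1) * s (Suc k) \<le> real k * (n - 1 - real k) * (s k)\<^sup>2"
    using newton_inequality_elem_sym[OF fin, of k x] k by (simp add: s_def n algebra_simps)
  have "c > 0" using k by (simp add: c_def n)
  have "s k + x a * s (k - 1) > 0" using pos[of k] ins by simp
  then have "c * (s k + x a * s (k - 1)) * ((n - real k) * s (Suc 0) * s (k - 1) - real k * (n - 1) * s k) > 0"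
    using \<open>c > 0\<close> D by (simp only: mult_pos_pos diff_gt_0_iff_gt)
  then have "0 < (c * (s k + x a * s (k - 1)) * ((n - real k) * s (Suc 0) * s (k - 1) - real k * (n - 1) * s k)
        + (real k * (n - 1 - real k) * (s k)\<^sup>2 - (real k + 1) * (n - real k) * s (k - 1) * s (Suc k))) / n"
    using G n by (intro divide_pos_pos add_pos_nonneg) linarith+
  also have "\<dots> = c * (c * (s k + x a * s (k - 1)) * (s (Suc 0) + x a) - (real k + 1) * (s (Suc k) + x a * s k)) * s (k - 1)
      - (c * (s k + x a * s (k - 1)) - s k)\<^sup>2"
    unfolding c_def using n by (intro deleted_entry_identity[symmetric]) auto
  finally show ?thesis unfolding ins by (simp add: s_def)
qed

section \<open>Newton identities\<close>

text \<open>
  Euler's relation for the homogeneous polynomial \<open>s\<^sub>j\<^sub>+\<^sub>1\<close>: its partial derivative in the direction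
  \<open>i\<close> is \<open>s\<^sub>j\<close> of the tuple without \<open>x i\<close>.
\<close>

lemma sum_mult_elem_sym_remove:
  assumes "finite I"
  shows "(\<Sum>i\<in>I. x i * elem_sym j (I - {i}) x) = (real j + 1) * elem_sym (Suc j) I x"
  using assms
proof (induction I arbitrary: j rule: finite_induct)
  case empty
  show ?case by (simp add: elem_sym_eq_0)
next
  case (insert a I)
  have remove: "insert a I - {i} = insert a (I - {i})" if "i \<in> I" for i
    using that insert(2) by auto
  have "(\<Sum>i\<in>insert a I. x i * elem_sym j (insert a I - {i}) x)
      = x a * elem_sym j I x + (\<Sum>i\<in>I. x i * elem_sym j (insert a (I - {i})) x)"
    unfolding sum.insert[OF insert(1,2)] using insert(2) by (simp add: remove)
  also have "\<dots> = (real j + 1) * elem_sym (Suc j) (insert a I) x"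
  proof (cases j)
    case 0
    then show ?thesis using insert(1,2) by (simp add: elem_sym_1)
  next
    case (Suc h)
    have "(\<Sum>i\<in>I. x i * elem_sym j (insert a (I - {i})) x)
        = (\<Sum>i\<in>I. x i * elem_sym j (I - {i}) x) + x a * (\<Sum>i\<in>I. x i * elem_sym h (I - {i}) x)"
      unfolding sum_distrib_left sum.distrib[symmetric]
    proof (intro sum.cong refl)
      fix i assume "i \<in> I"
      have "elem_sym j (insert a (I - {i})) x = elem_sym j (I - {i}) x + x a * elem_sym h (I - {i}) x"
        unfolding Suc using insert(1,2) by (intro elem_sym_Suc_insert) auto
      then show "x i * elem_sym j (insert a (I - {i})) x
          = x i * elem_sym j (I - {i}) x + x a * (x i * elem_sym h (I - {i}) x)"
        by (simp add: algebra_simps)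
    qed
    also have "\<dots> = (real j + 1) * elem_sym (Suc j) I x + x a * ((real h + 1) * elem_sym j I x)"
      unfolding insert(3) Suc ..
    finally show ?thesis
      by (simp add: Suc elem_sym_Suc_insert[OF insert(1,2)] algebra_simps)
  qed
  finally show ?case .
qed

text \<open>
  The eigenvalue of the Newton tensor for the eigenvalue \<open>x i\<close> of the matrix; it results from
  unwinding \<open>s\<^sub>j(x|i) = s\<^sub>j(x) - x\<^sub>i s\<^sub>j\<^sub>-\<^sub>1(x|i)\<close>.
\<close>

lemma elem_sym_remove_alternating_sum:
  assumes "finite I" "i \<in> I"
  shows "(\<Sum>l\<le>j. (- 1) ^ l * elem_sym (j - l) I x * x i ^ l) = elem_sym j (I - {i}) x"
proof (induction j)
  case 0
  then show ?case using assms by simp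
next
  case (Suc j)
  have "(\<Sum>l\<le>Suc j. (- 1) ^ l * elem_sym (Suc j - l) I x * x i ^ l)
      = elem_sym (Suc j) I x - x i * (\<Sum>l\<le>j. (- 1) ^ l * elem_sym (j - l) I x * x i ^ l)"
    by (subst sum.atMost_Suc_shift) (simp add: sum_distrib_left sum_negf algebra_simps)
  also have "\<dots> = elem_sym (Suc j) (I - {i}) x"
    unfolding Suc elem_sym_Suc_remove[OF assms] by simp
  finally show ?case .
qed

text \<open>
  The trace of the Newton tensor times the matrix, read off from its eigenvalues.
\<close>

lemma newton_identity:
  assumes "finite I"
  shows "(\<Sum>l\<le>j. (- 1) ^ l * elem_sym (j - l) I x * (\<Sum>i\<in>I. x i ^ Suc l)) = (real j + 1) * elem_sym (Suc j) I x"
proof -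
  have "(\<Sum>l\<le>j. (- 1) ^ l * elem_sym (j - l) I x * (\<Sum>i\<in>I. x i ^ Suc l))
      = (\<Sum>i\<in>I. x i * (\<Sum>l\<le>j. (- 1) ^ l * elem_sym (j - l) I x * x i ^ l))"
    unfolding sum_distrib_left by (subst sum.swap) (simp add: mult_ac)
  also have "\<dots> = (\<Sum>i\<in>I. x i * elem_sym j (I - {i}) x)"
    using assms by (simp add: elem_sym_remove_alternating_sum cong: sum.cong)
  finally show ?thesis using sum_mult_elem_sym_remove[OF assms] by simp
qed

section \<open>Traces of powers\<close>

lemma mat_trace_eq_sum: "mat_trace A = (\<Sum>i<dim_row A. A $$ (i, i))"
  by (simp add: mat_trace_def diag_mat_def interv_sum_list_conv_sum_set_nat atLeast0LessThan)

lemma mat_trace_mult: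
  assumes "A \<in> carrier_mat n m" "B \<in> carrier_mat m n"
  shows "mat_trace (A * B) = (\<Sum>i<n. \<Sum>j<m. A $$ (i, j) * B $$ (j, i))"
  using assms by (simp add: mat_trace_eq_sum scalar_prod_def atLeast0LessThan)

lemma mat_trace_mult_commute:
  assumes "A \<in> carrier_mat n m" "B \<in> carrier_mat m n"
  shows "mat_trace (A * B) = mat_trace (B * A)"
  unfolding mat_trace_mult[OF assms] mat_trace_mult[OF assms(2,1)]
  by (subst sum.swap) (simp add: mult.commute)

lemma upper_triangular_pow:
  assumes "B \<in> carrier_mat n n" "upper_triangular B"
  shows "upper_triangular (B ^\<^sub>m l) \<and> (\<forall>i<n. (B ^\<^sub>m l) $$ (i, i) = (B $$ (i, i)) ^ l)"
proof (induction l)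
  case 0
  then show ?case using assms(1) by auto
next
  case (Suc l)
  have C: "B ^\<^sub>m l \<in> carrier_mat n n" using assms(1) by simp
  have entry: "(B ^\<^sub>m Suc l) $$ (i, j) = (\<Sum>t<n. (B ^\<^sub>m l) $$ (i, t) * B $$ (t, j))"
    if "i < n" "j < n" for i j
    using that C assms(1) by (simp add: scalar_prod_def atLeast0LessThan)
  have low: "(B ^\<^sub>m l) $$ (i, j) = 0" "B $$ (i, j) = 0" if "j < i" "i < n" for i j
    using that Suc C assms by auto
  have "(B ^\<^sub>m Suc l) $$ (i, j) = 0" if "j < i" "i < n" for i j
  proof -
    have "(B ^\<^sub>m l) $$ (i, t) * B $$ (t, j) = 0" if "t < n" for t
      using low[of t i] low[of j t] that \<open>j < i\<close> \<open>i < n\<close> by (cases "t < i") auto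
    moreover have "j < n" using that by simp
    ultimately show ?thesis unfolding entry[OF \<open>i < n\<close> \<open>j < n\<close>] by (intro sum.neutral) auto
  qed
  then have "upper_triangular (B ^\<^sub>m Suc l)" using C assms(1) by auto
  moreover have "(B ^\<^sub>m Suc l) $$ (i, i) = (B $$ (i, i)) ^ Suc l" if i: "i < n" for i
  proof -
    have "(\<Sum>t<n. (B ^\<^sub>m l) $$ (i, t) * B $$ (t, i))
        = (\<Sum>t<n. if t = i then (B ^\<^sub>m l) $$ (i, i) * B $$ (i, i) else 0)"
    proof (rule sum.cong)
      fix t assume "t \<in> {..<n}"
      then show "(B ^\<^sub>m l) $$ (i, t) * B $$ (t, i)
          = (if t = i then (B ^\<^sub>m l) $$ (i, i) * B $$ (i, i) else 0)"
        using low[of t i] low[of i t] i by (cases t i rule: linorder_cases) auto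
    qed simp
    then show ?thesis unfolding entry[OF i i] using Suc i by (simp add: power_commutes)
  qed
  ultimately show ?case by simp
qed

text \<open>
  A Schur decomposition conjugates the matrix to an upper triangular one with the given roots on
  the diagonal, and conjugation preserves the trace and commutes with taking powers.
\<close>

lemma mat_trace_pow:
  assumes A: "A \<in> carrier_mat n n" and split: "char_poly A = (\<Prod>a\<leftarrow>es. [:- a, 1:])"
  shows "mat_trace (A ^\<^sub>m l) = (\<Sum>a\<leftarrow>es. a ^ l)"
proof -
  obtain B P Q where schur: "schur_decomposition A es = (B, P, Q)"
    by (cases "schur_decomposition A es")
  have sim: "similar_mat_wit A B P Q" and ut: "upper_triangular B" and diag: "diag_mat B = es"
    using schur_decomposition[OF A split schur] by auto
  note carrier = similar_mat_witD2[OF A sim]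
  have "mat_trace (A ^\<^sub>m l) = mat_trace (P * (B ^\<^sub>m l * Q))"
    using similar_mat_wit_pow_id[OF sim, of l] carrier by (simp add: assoc_mult_mat[of _ n n _ n _ n])
  also have "\<dots> = mat_trace (B ^\<^sub>m l * Q * P)"
    using carrier by (intro mat_trace_mult_commute[of _ n n]) auto
  also have "B ^\<^sub>m l * Q * P = B ^\<^sub>m l"
    using carrier by (subst assoc_mult_mat[of _ n n _ n _ n]) auto
  also have "mat_trace (B ^\<^sub>m l) = (\<Sum>i<n. (B $$ (i, i)) ^ l)"
    using upper_triangular_pow[OF _ ut, of n l] carrier by (simp add: mat_trace_eq_sum)
  also have "\<dots> = (\<Sum>a\<leftarrow>diag_mat B. a ^ l)"
    using carrier by (simp add: diag_mat_def comp_def interv_sum_list_conv_sum_set_nat atLeast0LessThan)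
  finally show ?thesis unfolding diag .
qed

section \<open>Eigenvalues of real symmetric matrices\<close>

text \<open>
  For an eigenvector \<open>v\<close> the Hermitian form \<open>S = v\<^sup>* A v\<close> equals \<open>z\<close> times the squared length of
  \<open>v\<close>, and it is real because the matrix is real and symmetric.
\<close>

lemma symmetric_eigenvalue_real:
  fixes A :: "real mat"
  assumes A: "A \<in> carrier_mat n n" and sym: "transpose_mat A = A"
    and z: "poly (char_poly (map_mat complex_of_real A)) z = 0"
  shows "z \<in> \<real>"
proof -
  let ?M = "map_mat complex_of_real A"
  have M: "?M \<in> carrier_mat n n" using A by simp
  have symij: "A $$ (i, j) = A $$ (j, i)" if "i < n" "j < n" for i j
    using that A sym by (metis carrier_matD index_transpose_mat(1))
  obtain v where "eigenvector ?M v z"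
    using z eigenvalue_root_char_poly[OF M] by (auto simp: eigenvalue_def)
  then have v: "v \<in> carrier_vec n" "v \<noteq> 0\<^sub>v n" and ev: "?M *\<^sub>v v = z \<cdot>\<^sub>v v"
    using A by (auto simp: eigenvector_def)
  have evi: "(\<Sum>j<n. of_real (A $$ (i, j)) * v $ j) = z * v $ i" if "i < n" for i
    using arg_cong[OF ev, of "\<lambda>w. w $ i"] that A v(1)
    by (simp add: scalar_prod_def atLeast0LessThan)
  define S where "S = (\<Sum>i<n. (\<Sum>j<n. of_real (A $$ (i, j)) * v $ j) * cnj (v $ i))"
  define r where "r = (\<Sum>i<n. (cmod (v $ i))\<^sup>2)"
  have "S = (\<Sum>i<n. z * v $ i * cnj (v $ i))"
    unfolding S_def using evi by simp
  also have "\<dots> = z * of_real r"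
    by (simp add: r_def sum_distrib_left mult.assoc complex_norm_square del: of_real_power)
  finally have Sr: "S = z * of_real r" .
  have "cnj S = (\<Sum>i<n. \<Sum>j<n. of_real (A $$ (i, j)) * cnj (v $ j) * v $ i)"
    by (simp add: S_def sum_distrib_right)
  also have "\<dots> = (\<Sum>j<n. \<Sum>i<n. of_real (A $$ (i, j)) * cnj (v $ j) * v $ i)"
    by (rule sum.swap)
  also have "\<dots> = S"
    unfolding S_def sum_distrib_right by (intro sum.cong) (auto simp: symij)
  finally have "S \<in> \<real>" by (simp add: Reals_cnj_iff)
  obtain i where i: "i < n" "v $ i \<noteq> 0"
    using v by (metis carrier_vecD eq_vecI index_zero_vec(1,2))
  then have "r > 0"
    unfolding r_def by (intro sum_pos2[of _ i]) auto
  then have "z = S / of_real r" using Sr by simp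
  then show ?thesis using \<open>S \<in> \<real>\<close> by simp
qed

text \<open>
  Over the complex numbers the characteristic polynomial splits, and its roots are real.
\<close>

lemma symmetric_char_poly_splits:
  fixes A :: "real mat"
  assumes A: "A \<in> carrier_mat n n" and sym: "transpose_mat A = A"
  obtains xs where "char_poly A = (\<Prod>x\<leftarrow>xs. [:- x, 1:])" "length xs = n"
proof -
  let ?M = "map_mat complex_of_real A"
  have M: "?M \<in> carrier_mat n n" using A by simp
  obtain zs where zs: "char_poly ?M = (\<Prod>z\<leftarrow>zs. [:- z, 1:])" "length zs = n"
    using char_poly_factorized[OF M] by auto
  have real: "z \<in> \<real>" if "z \<in> set zs" for z
  proof (rule symmetric_eigenvalue_real[OF A sym])
    show "poly (char_poly ?M) z = 0"
      unfolding zs(1) poly_prod_list using that by (auto simp: prod_list_zero_iff)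
  qed
  define xs where "xs = map Re zs"
  interpret hom: map_poly_inj_idom_hom complex_of_real ..
  have "map_poly complex_of_real (char_poly A) = char_poly ?M"
    by (rule of_real_hom.char_poly_hom[OF A, symmetric])
  also have "\<dots> = (\<Prod>z\<leftarrow>zs. map_poly complex_of_real [:- Re z, 1:])"
    unfolding zs(1) using real by (intro arg_cong[of _ _ prod_list] map_cong) auto
  also have "\<dots> = map_poly complex_of_real (\<Prod>x\<leftarrow>xs. [:- x, 1:])"
    by (simp only: hom.hom_prod_list xs_def map_map comp_def)
  finally have "char_poly A = (\<Prod>x\<leftarrow>xs. [:- x, 1:])" by (rule hom.injectivity)
  then show ?thesis using that[of xs] zs(2) by (simp add: xs_def)
qed

lemma proots_prod_linear_factors: "proots (\<Prod>x\<leftarrow>xs. [:- x, 1 :: 'a :: idom:]) = mset xs"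
proof (induction xs)
  case (Cons x xs)
  have "(\<Prod>x\<leftarrow>xs. [:- x, 1 :: 'a:]) \<noteq> 0" by (auto simp: prod_list_zero_iff)
  then show ?case using Cons by (simp add: proots_mult del: mult_pCons_left)
qed simp

lemma image_mset_nth: "image_mset ((!) xs) (mset_set {..<length xs}) = mset xs"
  by (metis atLeast_upt map_nth mset_map mset_set_set distinct_upt)

lemma sigma_eq_elem_sym:
  assumes "eigenvalue_tuple n A x"
  shows "sigma j A = elem_sym j {..<n} x"
proof -
  define ys where "ys = sorted_list_of_multiset (eigenvalues A)"
  have "image_mset ((!) ys) (mset_set {..<length ys}) = image_mset x (mset_set {..<n})"
    using assms by (simp add: image_mset_nth eigenvalue_tuple_def ys_def)
  then have "elem_sym j {..<length ys} ((!) ys) = elem_sym j {..<n} x"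
    by (intro elem_sym_cong_mset) auto
  then show ?thesis by (simp add: sigma_def ys_def[symmetric] Let_def)
qed

lemma symmetric_eigenvalue_tuple:
  assumes "A \<in> carrier_mat n n" "transpose_mat A = A"
  obtains x where "eigenvalue_tuple n A x"
proof -
  obtain xs where xs: "char_poly A = (\<Prod>x\<leftarrow>xs. [:- x, 1:])" "length xs = n"
    using symmetric_char_poly_splits[OF assms] .
  have "eigenvalues A = mset xs"
    unfolding eigenvalues_def xs(1) by (rule proots_prod_linear_factors)
  then have "eigenvalue_tuple n A ((!) xs)"
    using image_mset_nth[of xs] xs(2) by (simp add: eigenvalue_tuple_def)
  then show ?thesis by (rule that)
qed

lemma mat_trace_pow_eigenvalues:
  assumes "A \<in> carrier_mat n n" "transpose_mat A = A" "eigenvalue_tuple n A x"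
  shows "mat_trace (A ^\<^sub>m l) = (\<Sum>i<n. x i ^ l)"
proof -
  obtain xs where xs: "char_poly A = (\<Prod>x\<leftarrow>xs. [:- x, 1:])" "length xs = n"
    using symmetric_char_poly_splits[OF assms(1,2)] .
  have "eigenvalues A = mset xs"
    unfolding eigenvalues_def xs(1) by (rule proots_prod_linear_factors)
  then have eq: "image_mset x (mset_set {..<n}) = mset xs"
    using assms(3) by (simp add: eigenvalue_tuple_def)
  have "mat_trace (A ^\<^sub>m l) = (\<Sum>a\<leftarrow>xs. a ^ l)" by (rule mat_trace_pow[OF assms(1) xs(1)])
  also have "\<dots> = (\<Sum>a\<in>#mset xs. a ^ l)" by (simp add: sum_mset_sum_list[symmetric])
  also have "\<dots> = (\<Sum>i<n. x i ^ l)"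
    unfolding eq[symmetric] by (simp add: image_mset.compositionality comp_def sum_unfold_sum_mset)
  finally show ?thesis .
qed

text \<open>
  Expanding the tensor turns the trace into an alternating sum of power sums of the eigenvalues,
  which the Newton identities evaluate.
\<close>

lemma mat_trace_L_tensor_mult:
  assumes A: "A \<in> carrier_mat n n" and sym: "transpose_mat A = A" and x: "eigenvalue_tuple n A x"
  shows "mat_trace (L_tensor k A * A)
     = (real n - real k) / real n * elem_sym k {..<n} x * elem_sym (Suc 0) {..<n} x
         - (real k + 1) * elem_sym (Suc k) {..<n} x"
proof -
  define c where "c = (real n - real k) / real n * elem_sym k {..<n} x"
  define s where "s = (\<lambda>l. elem_sym l {..<n} x)"
  have sig: "sigma l A = s l" for l using sigma_eq_elem_sym[OF x] by (simp add: s_def)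
  have L: "L_tensor k A \<in> carrier_mat n n"
    using A by (auto simp: L_tensor_def newton_tensor_def Let_def)
  have entry: "L_tensor k A $$ (i, j) = c * (1\<^sub>m n) $$ (i, j) - (\<Sum>l\<le>k. (- 1) ^ l * s (k - l) * (A ^\<^sub>m l) $$ (i, j))"
    if "i < n" "j < n" for i j
    using that A by (simp add: L_tensor_def newton_tensor_def Let_def sig c_def s_def)
  have pow: "(\<Sum>i<n. \<Sum>j<n. (A ^\<^sub>m l) $$ (i, j) * A $$ (j, i)) = (\<Sum>i<n. x i ^ Suc l)" for l
    using mat_trace_mult[of "A ^\<^sub>m l" n n A] mat_trace_pow_eigenvalues[OF A sym x, of "Suc l"] A by simp
  have one: "(\<Sum>i<n. \<Sum>j<n. (1\<^sub>m n) $$ (i, j) * A $$ (j, i)) = (\<Sum>i<n. x i)"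
    using pow[of 0] A by simp
  have "mat_trace (L_tensor k A * A) = (\<Sum>i<n. \<Sum>j<n. L_tensor k A $$ (i, j) * A $$ (j, i))"
    by (rule mat_trace_mult[OF L A])
  also have "\<dots> = (\<Sum>i<n. \<Sum>j<n. c * ((1\<^sub>m n) $$ (i, j) * A $$ (j, i))
      - (\<Sum>l\<le>k. (- 1) ^ l * s (k - l) * ((A ^\<^sub>m l) $$ (i, j) * A $$ (j, i))))"
    by (intro sum.cong) (simp_all add: entry left_diff_distrib sum_distrib_right mult.assoc del: index_one_mat)
  also have "\<dots> = c * (\<Sum>i<n. \<Sum>j<n. (1\<^sub>m n) $$ (i, j) * A $$ (j, i))
      - (\<Sum>i<n. \<Sum>j<n. \<Sum>l\<le>k. (- 1) ^ l * s (k - l) * ((A ^\<^sub>m l) $$ (i, j) * A $$ (j, i)))"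
    by (simp only: sum_subtractf sum_distrib_left)
  also have "(\<Sum>i<n. \<Sum>j<n. \<Sum>l\<le>k. (- 1) ^ l * s (k - l) * ((A ^\<^sub>m l) $$ (i, j) * A $$ (j, i)))
      = (\<Sum>l\<le>k. (- 1) ^ l * s (k - l) * (\<Sum>i<n. \<Sum>j<n. (A ^\<^sub>m l) $$ (i, j) * A $$ (j, i)))"
    unfolding sum_distrib_left by (subst sum.swap[of _ "{..k}"], subst sum.swap[of _ "{..k}"]) simp
  finally show ?thesis
    unfolding pow one using newton_identity[of "{..<n}" k x]
    by (simp add: s_def c_def elem_sym_1)
qed

text \<open>
  By symmetry, \<open>tr ((A - a I)\<^sup>2)\<close> is the sum of the squared entries of \<open>A - a I\<close>, and in
  terms of \<open>tr A = n a\<close> and \<open>tr (A\<^sup>2) = n a\<^sup>2\<close> it is zero.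
\<close>

lemma symmetric_eq_smult_one:
  fixes A :: "real mat"
  assumes A: "A \<in> carrier_mat n n" and sym: "transpose_mat A = A" and x: "eigenvalue_tuple n A x"
    and const: "\<And>i. i < n \<Longrightarrow> x i = a"
  shows "A = a \<cdot>\<^sub>m 1\<^sub>m n"
proof -
  have symij: "A $$ (i, j) = A $$ (j, i)" if "i < n" "j < n" for i j
    using that A sym by (metis carrier_matD index_transpose_mat(1))
  have tr1: "(\<Sum>i<n. A $$ (i, i)) = real n * a"
    using mat_trace_pow_eigenvalues[OF A sym x, of 1] A const by (simp add: mat_trace_eq_sum)
  have "mat_trace (A ^\<^sub>m 2) = mat_trace (A * A)" using A by (simp add: numeral_2_eq_2)
  then have tr2: "(\<Sum>i<n. \<Sum>j<n. A $$ (i, j) * A $$ (j, i)) = real n * a\<^sup>2"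
    using mat_trace_pow_eigenvalues[OF A sym x, of 2] const mat_trace_mult[OF A A] by simp
  have "(\<Sum>i<n. \<Sum>j<n. (A $$ (i, j) - a * (if i = j then 1 else 0))\<^sup>2)
      = (\<Sum>i<n. \<Sum>j<n. A $$ (i, j) * A $$ (j, i) - 2 * a * (if j = i then A $$ (i, i) else 0) + (if j = i then a\<^sup>2 else 0))"
    by (intro sum.cong refl) (auto simp: symij power2_eq_square algebra_simps)
  also have "\<dots> = real n * a\<^sup>2 - 2 * a * (real n * a) + real n * a\<^sup>2"
    by (simp add: sum.distrib sum_subtractf sum_distrib_left[symmetric] tr1 tr2)
  also have "\<dots> = 0" by (simp add: power2_eq_square)
  finally have zero: "(\<Sum>i<n. \<Sum>j<n. (A $$ (i, j) - a * (if i = j then 1 else 0))\<^sup>2) = 0" .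
  have "A $$ (i, j) - a * (if i = j then 1 else 0) = 0" if "i < n" "j < n" for i j
    using zero that by (simp add: sum_nonneg_eq_0_iff sum_nonneg)
  then show ?thesis using A by (intro eq_matI) auto
qed

lemma elem_sym_const:
  assumes "finite I" "\<And>i. i \<in> I \<Longrightarrow> x i = a"
  shows "elem_sym k I x = real (card I choose k) * a ^ k"
proof -
  have "elem_sym k I x = (\<Sum>S | S \<subseteq> I \<and> card S = k. a ^ k)"
    unfolding elem_sym_def
  proof (intro sum.cong refl)
    fix S assume "S \<in> {S. S \<subseteq> I \<and> card S = k}"
    then show "prod x S = a ^ k" using assms(2) by (subst prod.cong[of S S x "\<lambda>_. a"]) auto
  qed
  then show ?thesis using n_subsets[OF assms(1), of k] by simp
qed

section \<open>The equality case\<close>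

theorem lemma2p5:
  fixes n k :: nat and A :: "real mat"
  assumes "k \<ge> 2" and "n \<ge> 2 * k" and "A \<in> Gamma_cone n k"
  shows "(\<forall>lam i. eigenvalue_tuple n A lam \<and> i < n \<and>
            ((real n - real k) / real n * sigma k A - elem_sym k ({..<n} - {i}) lam)\<^sup>2
              = (real n - real k) / real n * mat_trace (L_tensor k A * A)
                  * elem_sym (k - 1) ({..<n} - {i}) lam
          \<longrightarrow> (\<forall>p\<in>{..<n} - {i}. \<forall>q\<in>{..<n} - {i}. lam p = lam q))
       \<and> (mat_trace (L_tensor k A * A) = 0 \<longrightarrow>
            A = ((sigma k A / real (n choose k)) powr (1 / real k)) \<cdot>\<^sub>m 1\<^sub>m n)"
proof -
  define c where "c = (real n - real k) / real n"
  have A: "A \<in> carrier_mat n n" and sym: "transpose_mat A = A"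
    and pos: "\<And>j. 1 \<le> j \<Longrightarrow> j \<le> k \<Longrightarrow> sigma j A > 0"
    using assms(3) by (auto simp: Gamma_cone_def)
  \<comment> \<open>The inequality of which the hypothesis of the theorem is the equality case.\<close>
  have strict: "(c * sigma k A - elem_sym k ({..<n} - {i}) lam)\<^sup>2
      < c * mat_trace (L_tensor k A * A) * elem_sym (k - 1) ({..<n} - {i}) lam"
    if lam: "eigenvalue_tuple n A lam" and i: "i < n"
      and pq: "p \<in> {..<n} - {i}" "q \<in> {..<n} - {i}" "lam p \<noteq> lam q" for lam i p q
  proof -
    have ins: "insert i ({..<n} - {i}) = {..<n}" using i by auto
    have "elem_sym j {..<n} lam > 0" if "j \<le> k" for j
      using pos[of j] that sigma_eq_elem_sym[OF lam, of j] by (cases "j = 0") auto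
    then show ?thesis
      using deleted_entry_inequality[of "{..<n} - {i}" i k lam p q] pq assms(1,2) i
      unfolding ins mat_trace_L_tensor_mult[OF A sym lam] sigma_eq_elem_sym[OF lam] c_def
      by simp
  qed
  have "A = ((sigma k A / real (n choose k)) powr (1 / real k)) \<cdot>\<^sub>m 1\<^sub>m n"
    if tr: "mat_trace (L_tensor k A * A) = 0"
  proof -
    obtain x where x: "eigenvalue_tuple n A x" using symmetric_eigenvalue_tuple[OF A sym] .
    \<comment> \<open>As \<open>n \<ge> 3\<close>, some index other than \<open>p\<close> and \<open>q\<close> can be deleted.\<close>
    have all_eq: "x p = x q" if pq: "p < n" "q < n" for p q
    proof (rule ccontr)
      assume ne: "x p \<noteq> x q"
      have "card {p, q} < card {..<n}" using assms(1,2) by (auto simp: card_insert_if)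
      then obtain i where i: "i < n" "i \<noteq> p" "i \<noteq> q"
        by (metis card_mono finite.emptyI finite.insertI insertCI lessThan_iff not_le subsetI)
      have "(c * sigma k A - elem_sym k ({..<n} - {i}) x)\<^sup>2 < 0"
        using strict[OF x i(1), of p q] i pq ne tr by simp
      then show False by (simp add: not_less[symmetric])
    qed
    define a where "a = x 0"
    have const: "x i = a" if "i < n" for i using all_eq[of i 0] that by (simp add: a_def)
    have "sigma 1 A > 0" using pos assms(1) by simp
    then have "a > 0"
      using assms(1,2) sigma_eq_elem_sym[OF x, of 1] elem_sym_const[of "{..<n}" x a 1] const
      by (auto simp: zero_less_mult_iff)
    have "sigma k A = real (n choose k) * a ^ k"
      using sigma_eq_elem_sym[OF x, of k] elem_sym_const[of "{..<n}" x a k] const by simp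
    moreover have "n choose k > 0" using assms(2) by simp
    ultimately have "sigma k A / real (n choose k) = a ^ k" by simp
    then have "(sigma k A / real (n choose k)) powr (1 / real k) = a"
      using \<open>a > 0\<close> assms(1) by (simp add: powr_realpow[symmetric] powr_powr)
    then show ?thesis using symmetric_eq_smult_one[OF A sym x const] by simp
  qed
  then show ?thesis using strict unfolding c_def by (metis less_irrefl)
qed

end
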